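(* Let $\rho=(r_n)_n$ be an increasing sequence in $[0,1)$ with $r_n\to 1$. There exists $f\in\mathcal{U}_A(\mathbb{D},\rho)$ such that $S_n(f)(\zeta)\to\infty$ as $n\to\infty$ for $m$-almost every $\zeta\in\mathbb{T}$.
   Context: $\mathbb{D}$ is the open unit disc, $\mathbb{T}$ the unit circle, $m$ arclength measure on $\mathbb{T}$. For $f(z)=\sum_k a_kz^k\in H(\mathbb{D})$, $S_n(f)(z)=\sum_{k=0}^na_kz^k$. For $f\in H(\mathbb{D})$, $f_r(z):=f(rz)$; $\mathcal{U}_A(\mathbb{D},\rho)$ is the set of $f\in H(\mathbb{D})$ such that for every compact $K\subset\mathbb{T}$, $K\neq\mathbb{T}$, and every continuous $\varphi$ on $K$ there is an increasing sequence $(n_k)$ with $\sup_{\zeta\in K}|f_{r_{n_k}}(\zeta)-\varphi(\zeta)|\to0$. *)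

theory Defs
  imports "HOL-Complex_Analysis.Complex_Analysis"
begin

definition taylor_coeff :: "(complex \<Rightarrow> complex) \<Rightarrow> nat \<Rightarrow> complex" where
  "taylor_coeff f k = (deriv ^^ k) f 0 / of_nat (fact k)"

definition partial_sum :: "(complex \<Rightarrow> complex) \<Rightarrow> nat \<Rightarrow> complex \<Rightarrow> complex" where
  "partial_sum f n z = (\<Sum>k\<le>n. taylor_coeff f k * z ^ k)"

definition U_A :: "(nat \<Rightarrow> real) \<Rightarrow> (complex \<Rightarrow> complex) set" where
  "U_A \<rho> = {f. f holomorphic_on ball 0 1 \<and>
     (\<forall>K \<phi>. compact K \<and> K \<subseteq> sphere 0 1 \<and> K \<noteq> sphere 0 1 \<and> continuous_on K \<phi> \<longrightarrow>
        (\<exists>n. strict_mono n \<and>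
           uniform_limit K (\<lambda>k \<zeta>. f (complex_of_real (\<rho> (n k)) * \<zeta>)) \<phi> sequentially))}"

end

theory Submission
  imports Defs
begin

text \<open>
  The function is a limit of polynomials \<open>F k\<close>, where \<open>F (k+1) - F k = A + c B\<close>. By Runge and
  Stone--Weierstrass, the polynomial \<open>A = z^m q\<close> is small on the disc of the previous radius and
  corrects \<open>F k\<close> on the arc \<open>r K\<close> of the new radius \<open>r\<close> to the next target function. This leaves the
  partial sums of \<open>A\<close> on the unit circle out of control, which is repaired by
  \<open>B = (sum i = m..L. (s z)^i)\<close> with \<open>1 < s < 1/r\<close>: it is negligible on the disc of radius \<open>r\<close> for
  large \<open>m\<close>, whereas its partial sums grow like \<open>s^n\<close> everywhere on the unit circle. Hence
  for each point of the circle only few \<open>c\<close> in \<open>[1, 2]\<close> make some partial sum of \<open>F k + A + c B\<close>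
  small, and by Fubini some \<open>c\<close> is bad on a set of small measure only. Borel--Cantelli finishes
  the proof.
\<close>

section \<open>Runge approximation on an arc and a disc\<close>

definition poly_approximable :: "complex set \<Rightarrow> (complex \<Rightarrow> complex) \<Rightarrow> bool" where
  "poly_approximable X g \<longleftrightarrow> (\<forall>\<epsilon>>0. \<exists>p. \<forall>z\<in>X. cmod (poly p z - g z) < \<epsilon>)"

lemma poly_approximableD:
  assumes "poly_approximable X g" "\<epsilon> > 0"
  obtains p where "\<And>z. z \<in> X \<Longrightarrow> cmod (poly p z - g z) < \<epsilon>"
  using assms unfolding poly_approximable_def by meson

lemma poly_approximable_poly: "poly_approximable X (poly p)"
  unfolding poly_approximable_def by (intro allI impI exI[of _ p]) simp

lemma poly_approximable_const: "poly_approximable X (\<lambda>z. c)"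
  unfolding poly_approximable_def by (auto intro!: exI[of _ "[:c:]"])

lemma poly_approximable_ident: "poly_approximable X (\<lambda>z. z)"
  unfolding poly_approximable_def by (auto intro!: exI[of _ "[:0, 1:]"])

lemma poly_approximable_limit:
  assumes "\<And>\<epsilon>. \<epsilon> > 0 \<Longrightarrow> \<exists>g'. poly_approximable X g' \<and> (\<forall>z\<in>X. cmod (g' z - g z) < \<epsilon>)"
  shows "poly_approximable X g"
  unfolding poly_approximable_def
proof (intro allI impI)
  fix \<epsilon> :: real assume "\<epsilon> > 0"
  then obtain g' where g': "poly_approximable X g'" "\<And>z. z \<in> X \<Longrightarrow> cmod (g' z - g z) < \<epsilon>/2"
    using assms[of "\<epsilon>/2"] by auto
  obtain p where p: "\<And>z. z \<in> X \<Longrightarrow> cmod (poly p z - g' z) < \<epsilon>/2"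
    using poly_approximableD[OF g'(1), of "\<epsilon>/2"] \<open>\<epsilon> > 0\<close> by auto
  have "cmod (poly p z - g z) < \<epsilon>" if "z \<in> X" for z
    by (rule dist_triangle_half_l[of _ "g' z", unfolded dist_norm])
       (use p[OF that] g'(2)[OF that] in \<open>auto simp: norm_minus_commute\<close>)
  then show "\<exists>p. \<forall>z\<in>X. cmod (poly p z - g z) < \<epsilon>" by blast
qed

lemma poly_approximable_cong:
  assumes "poly_approximable X g" "\<And>z. z \<in> X \<Longrightarrow> g z = g' z"
  shows "poly_approximable X g'"
  using assms unfolding poly_approximable_def by (metis (no_types, lifting))

lemma poly_approximable_add:
  assumes "poly_approximable X g" "poly_approximable X h"
  shows "poly_approximable X (\<lambda>z. g z + h z)"
  unfolding poly_approximable_def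
proof (intro allI impI)
  fix \<epsilon> :: real assume "\<epsilon> > 0"
  obtain p where p: "\<And>z. z \<in> X \<Longrightarrow> cmod (poly p z - g z) < \<epsilon>/2"
    using poly_approximableD[OF assms(1), of "\<epsilon>/2"] \<open>\<epsilon> > 0\<close> by auto
  obtain q where q: "\<And>z. z \<in> X \<Longrightarrow> cmod (poly q z - h z) < \<epsilon>/2"
    using poly_approximableD[OF assms(2), of "\<epsilon>/2"] \<open>\<epsilon> > 0\<close> by auto
  have "cmod (poly (p + q) z - (g z + h z)) < \<epsilon>" if "z \<in> X" for z
    using norm_diff_triangle_ineq[of "poly p z" "poly q z" "g z" "h z"] p[OF that] q[OF that] by simp
  then show "\<exists>p. \<forall>z\<in>X. cmod (poly p z - (g z + h z)) < \<epsilon>" by blast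
qed

lemma poly_approximable_imp_bounded:
  assumes "compact X" "poly_approximable X g"
  obtains B where "B > 0" "\<And>z. z \<in> X \<Longrightarrow> cmod (g z) \<le> B"
proof -
  obtain p where p: "\<And>z. z \<in> X \<Longrightarrow> cmod (poly p z - g z) < 1"
    using poly_approximableD[OF assms(2), of 1] by auto
  have "compact (poly p ` X)"
    by (intro compact_continuous_image continuous_intros assms)
  then obtain B where B: "\<And>z. z \<in> X \<Longrightarrow> cmod (poly p z) \<le> B"
    using compact_imp_bounded bounded_iff by (metis imageI)
  have "cmod (g z) \<le> \<bar>B\<bar> + 1" if "z \<in> X" for z
    using norm_triangle_ineq3[of "poly p z" "g z"] p[OF that] B[OF that] by linarith
  then show thesis using that[of "\<bar>B\<bar> + 1"] by simp
qed

lemma poly_approximable_mult_poly: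
  assumes "compact X" "poly_approximable X g"
  shows "poly_approximable X (\<lambda>z. poly p z * g z)"
  unfolding poly_approximable_def
proof (intro allI impI)
  fix \<epsilon> :: real assume "\<epsilon> > 0"
  obtain B where B: "B > 0" "\<And>z. z \<in> X \<Longrightarrow> cmod (poly p z) \<le> B"
    using poly_approximable_imp_bounded[OF assms(1) poly_approximable_poly] by metis
  obtain q where q: "\<And>z. z \<in> X \<Longrightarrow> cmod (poly q z - g z) < \<epsilon>/B"
    using poly_approximableD[OF assms(2), of "\<epsilon>/B"] \<open>\<epsilon> > 0\<close> B(1) by (metis divide_pos_pos)
  have "cmod (poly (p * q) z - poly p z * g z) < \<epsilon>" if "z \<in> X" for z
  proof -
    have "cmod (poly (p * q) z - poly p z * g z) = cmod (poly p z) * cmod (poly q z - g z)"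
      by (simp add: norm_mult[symmetric] algebra_simps)
    also have "\<dots> \<le> B * cmod (poly q z - g z)"
      by (intro mult_right_mono B that) auto
    also have "\<dots> < \<epsilon>" using q[OF that] B(1) by (simp add: field_simps)
    finally show ?thesis .
  qed
  then show "\<exists>r. \<forall>z\<in>X. cmod (poly r z - poly p z * g z) < \<epsilon>" by blast
qed

text \<open>Only \<open>g\<close> is replaced by a polynomial, with an error measured against a
  bound for \<open>h\<close>; the product of that polynomial with \<open>h\<close> is covered by
  \<open>poly_approximable_mult_poly\<close>. Thus no bound depends on an approximant chosen
  later.\<close>

lemma poly_approximable_mult:
  assumes "compact X" "poly_approximable X g" "poly_approximable X h"
  shows "poly_approximable X (\<lambda>z. g z * h z)"
proof (rule poly_approximable_limit)
  fix \<epsilon> :: real assume "\<epsilon> > 0"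
  obtain B where B: "B > 0" "\<And>z. z \<in> X \<Longrightarrow> cmod (h z) \<le> B"
    using poly_approximable_imp_bounded[OF assms(1,3)] by metis
  obtain p where p: "\<And>z. z \<in> X \<Longrightarrow> cmod (poly p z - g z) < \<epsilon>/B"
    using poly_approximableD[OF assms(2), of "\<epsilon>/B"] \<open>\<epsilon> > 0\<close> B(1) by (metis divide_pos_pos)
  have "cmod (poly p z * h z - g z * h z) < \<epsilon>" if "z \<in> X" for z
  proof -
    have "cmod (poly p z * h z - g z * h z) = cmod (poly p z - g z) * cmod (h z)"
      by (simp add: norm_mult[symmetric] algebra_simps)
    also have "\<dots> \<le> cmod (poly p z - g z) * B"
      by (intro mult_left_mono B that) auto
    also have "\<dots> < \<epsilon>" using p[OF that] B(1) by (simp add: field_simps)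
    finally show ?thesis .
  qed
  then show "\<exists>g'. poly_approximable X g' \<and> (\<forall>z\<in>X. cmod (g' z - g z * h z) < \<epsilon>)"
    using poly_approximable_mult_poly[OF assms(1,3)] by blast
qed

lemma poly_approximable_power:
  assumes "compact X" "poly_approximable X g"
  shows "poly_approximable X (\<lambda>z. g z ^ n)"
  by (induction n) (auto intro: poly_approximable_const poly_approximable_mult assms)

lemma poly_approximable_sum:
  assumes "\<And>i. i \<in> I \<Longrightarrow> poly_approximable X (g i)"
  shows "poly_approximable X (\<lambda>z. \<Sum>i\<in>I. g i z)"
  using assms
  by (induction I rule: infinite_finite_induct)
     (auto intro: poly_approximable_const poly_approximable_add)

section \<open>Pole pushing\<close>

text \<open>The quotient is the sum of the geometric series with terms \<open>a z * b z ^ i\<close>,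
  whose partial sums are approximable and whose tail is at most \<open>B * q ^ n / (1 - q)\<close>
  on \<open>X\<close>.\<close>

lemma poly_approximable_neumann:
  assumes "compact X" "poly_approximable X a" "poly_approximable X b"
    and q: "q < 1" "\<And>z. z \<in> X \<Longrightarrow> cmod (b z) \<le> q"
  shows "poly_approximable X (\<lambda>z. a z / (1 - b z))"
proof (cases "X = {}")
  \<comment> \<open>On an empty \<open>X\<close> nothing prevents \<open>q\<close> from being
    negative, so the convergence of \<open>q ^ n\<close> could not be used.\<close>
  case True then show ?thesis unfolding poly_approximable_def by simp
next
  case False
  then have q0: "0 \<le> q" using q(2) norm_ge_zero order_trans by blast
  obtain B where B: "B > 0" "\<And>z. z \<in> X \<Longrightarrow> cmod (a z) \<le> B"
    using poly_approximable_imp_bounded[OF assms(1,2)] by metis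
  show ?thesis
  proof (rule poly_approximable_limit)
    fix \<epsilon> :: real assume "\<epsilon> > 0"
    have "(\<lambda>n. B / (1 - q) * q ^ n) \<longlonglongrightarrow> B / (1 - q) * 0"
      by (intro tendsto_mult tendsto_const LIMSEQ_realpow_zero q0 q)
    then have "eventually (\<lambda>n. B / (1 - q) * q ^ n < \<epsilon>) sequentially"
      using \<open>\<epsilon> > 0\<close> by (intro order_tendstoD) auto
    then obtain n where n: "B / (1 - q) * q ^ n < \<epsilon>"
      using eventually_sequentially by auto
    let ?g = "\<lambda>z. \<Sum>i<n. a z * b z ^ i"
    have "poly_approximable X ?g"
      by (intro poly_approximable_sum poly_approximable_mult poly_approximable_power assms)
    moreover have "cmod (?g z - a z / (1 - b z)) < \<epsilon>" if z: "z \<in> X" for z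
    proof -
      have b1: "b z \<noteq> 1" using q(1) q(2)[OF z] by auto
      have g: "?g z = a z * ((1 - b z ^ n) / (1 - b z))"
        using b1 by (simp add: sum_distrib_left[symmetric] sum_gp_strict)
      have "?g z - a z / (1 - b z) = - (a z * b z ^ n / (1 - b z))"
        unfolding g using b1 by (simp add: diff_divide_distrib right_diff_distrib)
      then have "cmod (?g z - a z / (1 - b z)) = cmod (a z) * cmod (b z) ^ n / cmod (1 - b z)"
        by (simp add: norm_mult norm_divide norm_power)
      also have "\<dots> \<le> B * q ^ n / (1 - q)"
      proof (intro frac_le mult_mono power_mono B q z)
        show "1 - q \<le> cmod (1 - b z)"
          using norm_triangle_ineq2[of 1 "b z"] q(2)[OF z] by simp
      qed (use B q q0 in auto)
      also have "\<dots> < \<epsilon>" using n by simp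
      finally show ?thesis .
    qed
    ultimately show "\<exists>g'. poly_approximable X g' \<and> (\<forall>z\<in>X. cmod (g' z - a z / (1 - b z)) < \<epsilon>)"
      by blast
  qed
qed

text \<open>Since \<open>w' - z = (w - z) - (w - w')\<close>, the function with pole
  \<open>w'\<close> is a Neumann series in the one with pole \<open>w\<close>, of ratio at most
  \<open>(d/2) / (3/4*d) = 2/3\<close>. The common centre \<open>\<xi>0\<close> makes the statement
  symmetric in the two poles, as induction over a connected set requires.\<close>

lemma poly_approximable_push_pole:
  assumes X: "compact X" and d: "d > 0" "\<And>z. z \<in> X \<Longrightarrow> d \<le> dist \<xi>0 z"
    and w: "dist \<xi>0 w < d/4" "dist \<xi>0 w' < d/4"
    and a: "poly_approximable X (\<lambda>z. 1 / (w - z))"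
  shows "poly_approximable X (\<lambda>z. 1 / (w' - z))"
proof -
  have far: "3/4*d \<le> cmod (w - z)" "3/4*d \<le> cmod (w' - z)" if "z \<in> X" for z
    using d(2)[OF that] w dist_triangle[of \<xi>0 z w] dist_triangle[of \<xi>0 z w'] by (auto simp: dist_norm)
  have ww: "cmod (w - w') \<le> d/2"
    using w dist_triangle3[of w w' \<xi>0] by (auto simp: dist_norm)
  have "poly_approximable X (\<lambda>z. (1 / (w - z)) / (1 - (w - w') * (1 / (w - z))))"
  proof (rule poly_approximable_neumann[OF X a, of _ "2/3"])
    show "poly_approximable X (\<lambda>z. (w - w') * (1 / (w - z)))"
      by (intro poly_approximable_mult X a poly_approximable_const)
    fix z assume z: "z \<in> X"
    have "cmod (w - w') / cmod (w - z) \<le> (d/2) / (3/4*d)"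
      by (intro frac_le) (use far[OF z] ww d in auto)
    then show "cmod ((w - w') * (1 / (w - z))) \<le> 2/3"
      using d(1) by (simp add: norm_divide)
  qed simp
  then show ?thesis
  proof (rule poly_approximable_cong)
    fix z assume z: "z \<in> X"
    have "w - z \<noteq> 0" "w' - z \<noteq> 0" using far[OF z] d(1) by auto
    then show "(1 / (w - z)) / (1 - (w - w') * (1 / (w - z))) = 1 / (w' - z)"
      by (simp add: divide_simps)
  qed
qed

text \<open>Runge's argument: at \<open>w0\<close> the pole is so far out that
  \<open>1 / (w0 - z)\<close> is a uniformly convergent power series in \<open>z / w0\<close>, and
  approximability then spreads locally along the connected set \<open>S\<close>, which avoids
  \<open>X\<close>.\<close>

lemma poly_approximable_pole:
  assumes X: "compact X" and S: "connected S" "S \<inter> X = {}" "w0 \<in> S" "w \<in> S"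
    and far: "\<And>z. z \<in> X \<Longrightarrow> cmod z \<le> q * cmod w0" "q < 1" "w0 \<noteq> 0"
  shows "poly_approximable X (\<lambda>z. 1 / (w - z))"
proof (rule connected_induction_simple[where P = "\<lambda>w. poly_approximable X (\<lambda>z. 1 / (w - z))",
      OF S(1) S(3,4)])
  have "poly_approximable X (\<lambda>z. (1/w0) / (1 - z * (1/w0)))"
  proof (rule poly_approximable_neumann[OF X])
    fix z assume "z \<in> X"
    then show "cmod (z * (1/w0)) \<le> q"
      using far by (simp add: norm_divide divide_simps)
  qed (intro poly_approximable_mult poly_approximable_const poly_approximable_ident X far)+
  then show "poly_approximable X (\<lambda>z. 1 / (w0 - z))"
    by (rule poly_approximable_cong) (use far in \<open>simp add: divide_simps\<close>)
next
  fix a assume a: "a \<in> S"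
  obtain d where d: "d > 0" "\<And>z. z \<in> X \<Longrightarrow> d \<le> dist a z"
    using separate_point_closed[of X a] X S(2) a compact_imp_closed by blast
  show "\<exists>T. openin (top_of_set S) T \<and> a \<in> T \<and>
     (\<forall>x\<in>T. \<forall>y\<in>T. poly_approximable X (\<lambda>z. 1 / (x - z)) \<longrightarrow> poly_approximable X (\<lambda>z. 1 / (y - z)))"
    by (rule exI[of _ "S \<inter> ball a (d/4)"])
       (use a d in \<open>auto intro: poly_approximable_push_pole[OF X d]\<close>)
qed

text \<open>Linear factors are split off one at a time by the fundamental theorem of algebra, so
  multiple zeros need no separate treatment as they would in a partial fraction
  decomposition.\<close>

lemma poly_approximable_inverse_poly:
  assumes X: "compact X" and w: "\<And>w. poly p w = 0 \<Longrightarrow> poly_approximable X (\<lambda>z. 1 / (w - z))"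
    and "p \<noteq> 0"
  shows "poly_approximable X (\<lambda>z. 1 / poly p z)"
  using w \<open>p \<noteq> 0\<close>
proof (induction "degree p" arbitrary: p)
  case 0
  then obtain c where "p = [:c:]" by (metis degree_eq_zeroE)
  then show ?case using poly_approximable_const by simp
next
  case (Suc n)
  have "\<exists>i\<in>{1..degree p}. coeff p i \<noteq> 0"
    using Suc.hyps(2) Suc.prems(2) by (intro bexI[of _ "degree p"]) auto
  then obtain w where "(\<Sum>i\<le>degree p. coeff p i * w ^ i) = 0"
    by (rule fundamental_theorem_of_algebra[OF disjI2])
  then have w: "poly p w = 0" by (simp add: poly_altdef)
  then obtain q where q: "p = [:-w, 1:] * q" using poly_eq_0_iff_dvd dvdE by metis
  have q0: "q \<noteq> 0" using q Suc.prems by auto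
  then have "degree p = Suc (degree q)" unfolding q by (subst degree_mult_eq) auto
  then have "poly_approximable X (\<lambda>z. 1 / poly q z)"
    using Suc q q0 by auto
  \<comment> \<open>The factor \<open>-1\<close> turns \<open>1 / (w - z)\<close> into the inverse
    of the linear factor \<open>z - w\<close>.\<close>
  then have "poly_approximable X (\<lambda>z. (-1) * (1 / (w - z)) * (1 / poly q z))"
    by (intro poly_approximable_mult X poly_approximable_const Suc.prems w)
  then show ?case
    by (rule poly_approximable_cong) (auto simp: q divide_simps left_diff_distrib)
qed

text \<open>
  For \<open>x < y < 1\<close> the functions \<open>(z/y)^n / (1 + (z/y)^n)\<close> converge to the indicator. Their poles lie
  on the circle of radius \<open>y\<close> and can be pushed to infinity through the gap at \<open>g\<close>.
\<close>

lemma poly_approximable_indicator: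
  assumes K: "compact K" "K \<subseteq> sphere 0 1" "g \<in> sphere 0 1" "g \<notin> K" and x: "0 \<le> x" "x < 1"
  shows "poly_approximable (K \<union> cball 0 x) (\<lambda>z. if z \<in> K then 1 else 0)"
proof (rule poly_approximable_limit)
  fix \<epsilon> :: real assume \<epsilon>: "\<epsilon> > 0"
  let ?X = "K \<union> cball 0 x"
  have X: "compact ?X" using K by auto
  define y where "y = (x + 1) / 2"
  have y: "x < y" "y < 1" "0 < y" using x unfolding y_def by auto
  \<comment> \<open>The poles are moved inside the annulus \<open>?A\<close> to the ray
    \<open>?R\<close>, and along it across the unit circle. The ray meets that circle only at
    \<open>g\<close>, so the union of the two sets avoids \<open>?X\<close>.\<close>
  let ?A = "{z. x < norm (z - 0) \<and> norm (z - 0) < 1} :: complex set"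
  let ?R = "(\<lambda>t. complex_of_real t * g) ` {x<..}"
  have "connected ((\<lambda>(t, \<theta>). complex_of_real t * cis \<theta>) ` ({x<..<1} \<times> UNIV))"
    unfolding case_prod_beta
    by (intro connected_continuous_image continuous_intros convex_connected convex_Times) auto
  also have "(\<lambda>(t, \<theta>). complex_of_real t * cis \<theta>) ` ({x<..<1} \<times> UNIV) = ?A"
  proof (intro equalityI subsetI)
    fix z assume z: "z \<in> ?A"
    have "z = (\<lambda>(t, \<theta>). complex_of_real t * cis \<theta>) (cmod z, Arg z)"
      using rcis_cmod_Arg[of z] by (simp add: rcis_def)
    then show "z \<in> (\<lambda>(t, \<theta>). complex_of_real t * cis \<theta>) ` ({x<..<1} \<times> UNIV)"
      using z by (intro image_eqI[of _ _ "(cmod z, Arg z)"]) auto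
  qed (use x in \<open>auto simp: norm_mult\<close>)
  finally have "connected ?A" .
  moreover have "connected ?R"
    by (intro connected_continuous_image continuous_intros) auto
  moreover have "complex_of_real y * g \<in> ?A \<inter> ?R"
    using K y by (auto simp: norm_mult)
  ultimately have con: "connected (?A \<union> ?R)" by (intro connected_Un) auto
  have R1: "z = g" if "z \<in> ?R" "cmod z = 1" for z
    using that K x by (auto simp: norm_mult)
  have disj: "(?A \<union> ?R) \<inter> ?X = {}"
    using K x R1 by (force simp: norm_mult)
  have pole: "poly_approximable ?X (\<lambda>z. 1 / (w - z))" if "cmod w = y" for w
  \<comment> \<open>The path starts at \<open>2 * g\<close>: every point of \<open>?X\<close> has
    modulus at most 1, which is half the modulus of \<open>2 * g\<close>.\<close>
  proof (rule poly_approximable_pole[OF X con disj, of "complex_of_real 2 * g" w "1/2"])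
    show "complex_of_real 2 * g \<in> ?A \<union> ?R" using x by (intro UnI2 imageI) auto
    show "w \<in> ?A \<union> ?R" using that y by auto
  qed (use K x in \<open>auto simp: norm_mult\<close>)
  \<comment> \<open>The modulus of \<open>(z/y)^n\<close> is at most \<open>(x/y)^n\<close> on the
    disc and equals \<open>1/y^n\<close> on \<open>K\<close>, so both sequences must be small. The
    bound \<open>1/2\<close> keeps the denominator \<open>1 + (z/y)^n\<close> away from
    zero.\<close>
  have "(\<lambda>n. (x/y)^n) \<longlonglongrightarrow> 0" "(\<lambda>n. y^n) \<longlonglongrightarrow> 0"
    by (intro LIMSEQ_realpow_zero; use x y in simp)+
  then have "eventually (\<lambda>n. (x/y)^n < min (1/2) (\<epsilon>/2)) sequentially"
      "eventually (\<lambda>n. y^n < min (1/2) (\<epsilon>/2)) sequentially"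
    using \<epsilon> by (intro order_tendstoD(2)[where y = 0]; simp)+
  then have "eventually (\<lambda>n. (x/y)^n < min (1/2) (\<epsilon>/2) \<and> y^n < min (1/2) (\<epsilon>/2)) sequentially"
    by eventually_elim simp
  then obtain n where n: "(x/y)^n < min (1/2) (\<epsilon>/2)" "y^n < min (1/2) (\<epsilon>/2)"
    using eventually_sequentially by auto
  have "n \<noteq> 0" using n by (auto intro!: Nat.gr0I)
  define p where "p = 1 + monom (complex_of_real (1/y^n)) n"
  have p: "poly p z = 1 + (z / of_real y)^n" for z
    unfolding p_def by (simp add: poly_monom power_divide)
  have p0: "p \<noteq> 0"
  proof
    assume "p = 0"
    then have "poly p 0 = 0" by simp
    with \<open>n \<noteq> 0\<close> show False unfolding p by (simp add: power_0_left)
  qed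
  have root: "cmod w = y" if "poly p w = 0" for w
  proof -
    have "(w / of_real y)^n = -1" using that unfolding p by (simp add: add_eq_0_iff)
    then have "cmod (w / of_real y) ^ n = 1" by (metis norm_minus_cancel norm_one norm_power)
    then have "cmod (w / of_real y) = 1" using power_eq_1_iff[of "cmod (w / of_real y)" n] \<open>n \<noteq> 0\<close> by simp
    then show ?thesis using y by (simp add: norm_divide divide_simps split: if_splits)
  qed
  \<comment> \<open>The approximant \<open>(z/y)^n / (1 + (z/y)^n)\<close> is written as
    \<open>1 - 1 / poly p z\<close> to suit the closure lemmas.\<close>
  have ap: "poly_approximable ?X (\<lambda>z. 1 + (-1) * (1 / poly p z))"
    by (intro poly_approximable_add poly_approximable_mult X poly_approximable_const
        poly_approximable_inverse_poly pole root p0)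
  have "cmod (1 + (-1) * (1 / poly p z) - (if z \<in> K then 1 else 0)) < \<epsilon>" if z: "z \<in> ?X" for z
  proof (cases "z \<in> K")
    case True
    then have z1: "cmod z = 1" using K by auto
    define Y where "Y = 1 / y^n"
    have Y: "Y > 2" "2 / Y < \<epsilon>" unfolding Y_def using n y by (auto simp: less_divide_eq)
    have "cmod ((z / of_real y)^n) = Y"
      using z1 y unfolding Y_def by (simp add: norm_divide norm_power power_divide)
    then have "Y - 1 \<le> cmod (poly p z)"
      using norm_triangle_ineq2[of "(z / of_real y)^n" "-1"] unfolding p by (simp add: add.commute)
    with Y have "Y / 2 \<le> cmod (poly p z)" by simp
    then have "1 / cmod (poly p z) \<le> 1 / (Y / 2)"
      by (rule divide_left_mono) (use Y \<open>Y / 2 \<le> cmod (poly p z)\<close> in \<open>auto intro!: mult_pos_pos\<close>)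
    also have "\<dots> < \<epsilon>" using Y by simp
    finally show ?thesis using True by (simp add: norm_divide)
  next
    case False
    then have z1: "cmod z \<le> x" using z by auto
    have "cmod ((z / of_real y)^n) \<le> (x/y)^n"
      unfolding norm_power by (intro power_mono) (use z1 y in \<open>auto simp: norm_divide divide_right_mono\<close>)
    then have b: "cmod ((z / of_real y)^n) < 1/2" "cmod ((z / of_real y)^n) < \<epsilon>/2" using n by auto
    then have "cmod (poly p z) \<ge> 1/2"
      using norm_triangle_ineq2[of 1 "- ((z / of_real y)^n)"] unfolding p by simp
    then have pz: "poly p z \<noteq> 0" "cmod (poly p z) \<ge> 1/2" by auto
    have "1 + (-1) * (1 / poly p z) = (z / of_real y)^n / poly p z"
      using pz(1) p[of z] by (simp add: field_simps)
    then have "cmod (1 + (-1) * (1 / poly p z)) = cmod ((z / of_real y)^n) / cmod (poly p z)"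
      by (simp add: norm_divide)
    also have "\<dots> \<le> cmod ((z / of_real y)^n) / (1/2)"
      by (rule divide_left_mono) (use pz in auto)
    also have "\<dots> < \<epsilon>" using b by simp
    finally show ?thesis using False by simp
  qed
  then show "\<exists>g'. poly_approximable ?X g' \<and> (\<forall>z\<in>?X. cmod (g' z - (if z \<in> K then 1 else 0)) < \<epsilon>)"
    using ap by blast
qed

section \<open>Approximation on proper compact subsets of the circle\<close>

text \<open>On the circle \<open>cnj z = 1/z\<close>, and the pole at 0 can be pushed to infinity
  through the gap at \<open>g\<close>. Hence \<open>cnj\<close> is approximable on \<open>K\<close>,
  so are all real polynomials in the real and imaginary parts, and Stone-Weierstrass gives the
  rest.\<close>

lemma poly_approximable_arc:
  assumes K: "compact K" "K \<subseteq> sphere 0 1" "g \<in> sphere 0 1" "g \<notin> K" and h: "continuous_on K h"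
  shows "poly_approximable K h"
proof -
  let ?R = "(\<lambda>t. complex_of_real t * g) ` {0..}"
  have inv: "poly_approximable K (\<lambda>z. 1 / (0 - z))"
  proof (rule poly_approximable_pole[OF K(1), of ?R "complex_of_real 2 * g" 0 "1/2"])
    show "connected ?R"
      by (intro connected_continuous_image continuous_intros) auto
    have "z = g" if "z \<in> ?R" "cmod z = 1" for z using that K by (auto simp: norm_mult)
    then show "?R \<inter> K = {}" using K by force
    show "complex_of_real 2 * g \<in> ?R" by (intro imageI) auto
    show "0 \<in> ?R" by (rule image_eqI[of _ _ 0]) auto
  qed (use K in \<open>auto simp: norm_mult\<close>)
  have cnj: "poly_approximable K cnj"
  proof (rule poly_approximable_cong)
    show "poly_approximable K (\<lambda>z. (-1) * (1 / (0 - z)))"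
      by (intro poly_approximable_mult K inv poly_approximable_const)
    fix z assume "z \<in> K"
    then have "z * cnj z = 1" using K by (auto simp: complex_norm_square[symmetric])
    then show "(-1) * (1 / (0 - z)) = cnj z" by (auto simp: divide_simps mult.commute)
  qed
  have rp: "poly_approximable K (\<lambda>z. complex_of_real (f z))" if "real_polynomial_function f" for f
    using that
  proof induction
    case (linear f)
    interpret bounded_linear f by fact
    \<comment> \<open>A real-linear functional is determined by its values at \<open>1\<close> and
      \<open>\<i>\<close>; the two brackets are the real and imaginary parts of \<open>z\<close> in
      terms of \<open>z\<close> and \<open>cnj z\<close>.\<close>
    have "poly_approximable K (\<lambda>z. of_real (f 1) * ((1/2) * (z + cnj z)) + of_real (f \<i>) * ((1/(2*\<i>)) * (z + (-1) * cnj z)))"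
      by (intro poly_approximable_add poly_approximable_mult K(1) poly_approximable_const
          poly_approximable_ident cnj)
    then show ?case
    proof (rule poly_approximable_cong)
      fix z :: complex
      have "z = Re z *\<^sub>R 1 + Im z *\<^sub>R \<i>" by (simp add: complex_eq_iff)
      then have "f z = f (Re z *\<^sub>R 1 + Im z *\<^sub>R \<i>)" by (rule arg_cong)
      then have "f z = Re z * f 1 + Im z * f \<i>" by (simp add: add scaleR)
      moreover have "(1/2) * (z + cnj z) = of_real (Re z)" "(1/(2*\<i>)) * (z + (-1) * cnj z) = of_real (Im z)"
        by (auto simp: complex_eq_iff)
      ultimately show "of_real (f 1) * ((1/2) * (z + cnj z)) + of_real (f \<i>) * ((1/(2*\<i>)) * (z + (-1) * cnj z))
          = complex_of_real (f z)"
        by simp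
    qed
  next
    case (const c) then show ?case by (simp add: poly_approximable_const)
  next
    case (add f g) then show ?case by (simp add: poly_approximable_add)
  next
    case (mult f g) then show ?case by (simp add: poly_approximable_mult K)
  qed
  have re: "poly_approximable K (\<lambda>z. complex_of_real (f z))" if "continuous_on K f" for f
  proof (rule poly_approximable_limit)
    fix \<epsilon> :: real assume "\<epsilon> > 0"
    then obtain p where p: "real_polynomial_function p" "\<And>z. z \<in> K \<Longrightarrow> \<bar>f z - p z\<bar> < \<epsilon>"
      using Stone_Weierstrass_real_polynomial_function[OF K(1) \<open>continuous_on K f\<close>] by blast
    have "cmod (complex_of_real (p z) - complex_of_real (f z)) < \<epsilon>" if "z \<in> K" for z
      unfolding of_real_diff[symmetric] norm_of_real using p(2)[OF that] by linarith
    then show "\<exists>g'. poly_approximable K g' \<and> (\<forall>z\<in>K. cmod (g' z - complex_of_real (f z)) < \<epsilon>)"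
      using rp[OF p(1)] by blast
  qed
  have "poly_approximable K (\<lambda>z. of_real (Re (h z)) + \<i> * of_real (Im (h z)))"
    by (intro poly_approximable_add poly_approximable_mult K poly_approximable_const re continuous_intros h)
  then show ?thesis
    by (simp add: complex_eq[symmetric])
qed

text \<open>Division by \<open>r\<close> moves the arc to the unit circle and the disc to radius
  \<open>x/r < 1\<close>. There \<open>h z / z^m\<close> is approximated on \<open>K\<close> by a
  polynomial \<open>p\<close>, and \<open>p\<close> times the indicator of \<open>K\<close> is
  approximated on the union of \<open>K\<close> and the disc. The factor \<open>z^m\<close> later
  keeps the low Taylor coefficients unchanged.\<close>

lemma polynomial_approximation_arc_disc:
  assumes K: "compact K" "K \<subseteq> sphere 0 1" "K \<noteq> sphere 0 1" and x: "0 \<le> x" "x < r"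
    and h: "continuous_on K h" and e: "\<epsilon> > 0"
  obtains q where "\<And>z. cmod z \<le> x \<Longrightarrow> cmod (z ^ m * poly q z) < \<epsilon>"
    and "\<And>z. z \<in> K \<Longrightarrow> cmod ((of_real r * z) ^ m * poly q (of_real r * z) - h z) < \<epsilon>"
proof -
  obtain g where g: "g \<in> sphere 0 1" "g \<notin> K" using K(2,3) by blast
  let ?X = "K \<union> cball 0 (x/r)"
  have r: "r > 0" "0 \<le> x/r" "x/r < 1" using x by auto
  have X: "compact ?X" using K by auto
  have K1: "cmod z = 1" if "z \<in> K" for z using K that by auto
  have hm: "continuous_on K (\<lambda>z. h z / z^m)"
  proof (intro continuous_intros h ballI)
    show "z ^ m \<noteq> 0" if "z \<in> K" for z using K1[OF that] by auto
  qed
  obtain p where p: "\<And>z. z \<in> K \<Longrightarrow> cmod (poly p z - h z / z^m) < \<epsilon>/2"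
    using poly_approximableD[OF poly_approximable_arc[OF K(1,2) g hm], of "\<epsilon>/2"] e by auto
  have ap: "poly_approximable ?X (\<lambda>z. poly p z * (if z \<in> K then 1 else 0))"
    by (intro poly_approximable_mult_poly X poly_approximable_indicator[OF K(1,2) g r(2,3)])
  obtain s where s: "\<And>z. z \<in> ?X \<Longrightarrow> cmod (poly s z - poly p z * (if z \<in> K then 1 else 0)) < \<epsilon>/2"
    using poly_approximableD[OF ap half_gt_zero[OF e]] by blast
  \<comment> \<open>The scalar cancels the power of \<open>r\<close>, so that
    \<open>z^m * poly q z\<close> is the rescaling of \<open>z^m * poly s z\<close>.\<close>
  define q where "q = smult (1 / of_real r ^ m) (pcompose s [:0, 1 / of_real r:])"
  have q: "z ^ m * poly q z = (z / of_real r)^m * poly s (z / of_real r)" for z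
    unfolding q_def by (simp add: poly_pcompose power_divide)
  show thesis
  proof (rule that[of q])
    fix z :: complex assume z: "cmod z \<le> x"
    let ?w = "z / of_real r"
    have w: "cmod ?w \<le> x/r" using z r by (simp add: norm_divide divide_right_mono)
    then have "?w \<notin> K" using K1 r by force
    then have s1: "cmod (poly s ?w) < \<epsilon>/2" using s[of ?w] w by simp
    have "cmod ?w \<le> 1" using w r(3) by linarith
    then have "cmod (?w ^ m * poly s ?w) \<le> 1 * cmod (poly s ?w)"
      unfolding norm_mult norm_power by (intro mult_right_mono power_le_one) auto
    then show "cmod (z ^ m * poly q z) < \<epsilon>" unfolding q using s1 e by simp
  next
    fix z assume z: "z \<in> K"
    have "cmod (poly s z - poly p z) < \<epsilon>/2" using s[of z] z by simp
    then have "cmod (poly s z - h z / z^m) < \<epsilon>"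
      using p[OF z] norm_triangle_ineq[of "poly s z - poly p z" "poly p z - h z / z^m"] by simp
    moreover have "z ^ m * poly s z - h z = z^m * (poly s z - h z / z^m)"
    proof -
      have "z^m \<noteq> 0" using K1[OF z] by auto
      then show ?thesis by (simp add: right_diff_distrib)
    qed
    moreover have "cmod (z^m) = 1" using K1[OF z] by (simp add: norm_power)
    ultimately have "cmod (z ^ m * poly s z - h z) < \<epsilon>" by (simp add: norm_mult)
    then show "cmod ((of_real r * z) ^ m * poly q (of_real r * z) - h z) < \<epsilon>"
      unfolding q using r by simp
  qed
qed

section \<open>Forcing large partial sums\<close>

text \<open>With \<open>w = s * \<zeta>\<close> of modulus \<open>s\<close>, the sum is
  \<open>(w^(n+1) - w^m) / (w - 1)\<close>; the numerator has modulus at least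
  \<open>s^(n+1) - s^n\<close>, the denominator at most \<open>s + 1\<close>.\<close>

lemma norm_geometric_sum_ge:
  fixes \<zeta> :: complex
  assumes "s > 1" "cmod \<zeta> = 1" "m \<le> n"
  shows "s ^ n * (s - 1) / (s + 1) \<le> cmod (\<Sum>i=m..n. (of_real s * \<zeta>) ^ i)"
proof -
  let ?w = "of_real s * \<zeta>"
  have nw: "cmod ?w = s" using assms by (simp add: norm_mult)
  have w1: "?w \<noteq> 1" using nw assms(1) by auto
  have "(\<Sum>i=m..n. ?w ^ i) = (?w ^ m - ?w ^ Suc n) / (1 - ?w)"
    using w1 assms(3) by (simp add: sum_gp)
  then have eq: "cmod (\<Sum>i=m..n. ?w ^ i) = cmod (?w ^ Suc n - ?w ^ m) / cmod (?w - 1)"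
    by (simp add: norm_divide norm_minus_commute)
  have "s ^ m \<le> s ^ n" using assms by (intro power_increasing) auto
  then have "s ^ n * (s - 1) \<le> s ^ Suc n - s ^ m" by (simp add: algebra_simps)
  also have "\<dots> \<le> cmod (?w ^ Suc n - ?w ^ m)"
    using norm_triangle_ineq2[of "?w ^ Suc n" "?w ^ m"] unfolding norm_power nw .
  finally have 1: "s ^ n * (s - 1) \<le> cmod (?w ^ Suc n - ?w ^ m)" .
  have 2: "cmod (?w - 1) \<le> s + 1" using norm_triangle_ineq4[of ?w 1] nw by simp
  have "0 < cmod (?w - 1)" using w1 by simp
  then show ?thesis unfolding eq using 1 2 assms(1) by (intro frac_le) auto
qed

text \<open>Two parameters in the set differ by less than \<open>2 * M / b\<close>, so the set lies
  in an interval of length \<open>4 * M / b\<close> centred at any one of them.\<close>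

lemma emeasure_parameter_near_zero_le:
  fixes X B :: complex
  assumes "b > 0" "b \<le> cmod B" "M > 0"
  shows "emeasure lborel {c\<in>{1..2::real}. cmod (X + of_real c * B) < M} \<le> ennreal (4 * M / b)"
proof (cases "\<exists>c0\<in>{1..2::real}. cmod (X + of_real c0 * B) < M")
  case True
  then obtain c0 where c0: "cmod (X + of_real c0 * B) < M" by blast
  have "{c\<in>{1..2::real}. cmod (X + of_real c * B) < M} \<subseteq> {c0 - 2*M/b .. c0 + 2*M/b}"
  proof clarify
    fix c :: real assume c: "cmod (X + of_real c * B) < M"
    have "(X + of_real c * B) - (X + of_real c0 * B) = of_real (c - c0) * B"
      by (simp add: algebra_simps)
    then have "\<bar>c - c0\<bar> * cmod B = cmod ((X + of_real c * B) - (X + of_real c0 * B))"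
      by (simp only: norm_mult norm_of_real)
    also have "\<dots> < 2 * M" using norm_triangle_ineq4[of "X + of_real c * B" "X + of_real c0 * B"] c c0 by linarith
    finally have "\<bar>c - c0\<bar> * b < 2 * M"
      using mult_left_mono[OF assms(2), of "\<bar>c - c0\<bar>"] by linarith
    then have "\<bar>c - c0\<bar> < 2 * M / b" using assms by (simp add: field_simps)
    then show "c \<in> {c0 - 2*M/b .. c0 + 2*M/b}" by (auto simp: abs_less_iff)
  qed
  then have "emeasure lborel {c\<in>{1..2::real}. cmod (X + of_real c * B) < M}
      \<le> emeasure lborel {c0 - 2*M/b .. c0 + 2*M/b}"
    by (intro emeasure_mono) auto
  also have "\<dots> = ennreal (4 * M / b)"
    using assms by (subst emeasure_lborel_Icc) (auto simp: field_simps)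
  finally show ?thesis .
next
  case False
  then have "{c\<in>{1..2::real}. cmod (X + of_real c * B) < M} = {}" by blast
  then show ?thesis by (simp only: emeasure_empty zero_le)
qed

text \<open>Fubini for the bad pairs \<open>(c, t)\<close>: for fixed \<open>t\<close> the bad
  parameters have measure at most \<open>\<kappa>\<close>, so the total is at most
  \<open>\<kappa> * (2 * pi) < e\<close>. If every \<open>c\<close> in the interval had a bad set of
  measure above \<open>e\<close>, the total would be at least \<open>e\<close>.\<close>

lemma exists_parameter_small_bad_set:
  fixes X B :: "'i \<Rightarrow> real \<Rightarrow> complex"
  assumes "finite I" and X: "\<And>n. continuous_on UNIV (X n)" and B: "\<And>n. continuous_on UNIV (B n)"
    and b: "\<And>n. n \<in> I \<Longrightarrow> b n > 0" "\<And>n t. n \<in> I \<Longrightarrow> b n \<le> cmod (B n t)"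
    and M: "M > 0" and e: "(\<Sum>n\<in>I. 4 * M / b n) * (2 * pi) < e"
  obtains c :: real where "c \<in> {1..2}"
    "{t\<in>{0..2*pi}. \<exists>n\<in>I. cmod (X n t + of_real c * B n t) < M} \<in> sets lborel"
    "emeasure lborel {t\<in>{0..2*pi}. \<exists>n\<in>I. cmod (X n t + of_real c * B n t) < M} \<le> ennreal e"
proof -
  define \<kappa> where "\<kappa> = (\<Sum>n\<in>I. 4 * M / b n)"
  have \<kappa>: "\<kappa> \<ge> 0" unfolding \<kappa>_def using b M by (intro sum_nonneg) (auto intro: less_imp_le)
  define S where "S = (\<Union>n\<in>I. {p :: real \<times> real. cmod (X n (snd p) + of_real (fst p) * B n (snd p)) < M})
      \<inter> ({1..2} \<times> {0..2*pi})"
  have Xs: "continuous_on UNIV (\<lambda>p :: real \<times> real. X n (snd p))" for n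
    by (rule continuous_on_compose2[OF X continuous_on_snd]) auto
  have Bs: "continuous_on UNIV (\<lambda>p :: real \<times> real. B n (snd p))" for n
    by (rule continuous_on_compose2[OF B continuous_on_snd]) auto
  have op: "open {p :: real \<times> real. cmod (X n (snd p) + of_real (fst p) * B n (snd p)) < M}" for n
    by (intro open_Collect_less continuous_intros Xs Bs)
  have "S \<in> sets borel"
    unfolding S_def
  proof (rule sets.Int)
    show "(\<Union>n\<in>I. {p :: real \<times> real. cmod (X n (snd p) + of_real (fst p) * B n (snd p)) < M}) \<in> sets borel"
      by (intro borel_open open_UN ballI op)
    show "{1..2::real} \<times> {0..2*pi} \<in> sets borel"
      by (intro borel_closed closed_Times closed_atLeastAtMost)
  qed
  then have S: "S \<in> sets (lborel \<Otimes>\<^sub>M lborel)"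
    by (simp only: lborel_prod sets_lborel)
  define E where "E c = {t\<in>{0..2*pi}. \<exists>n\<in>I. cmod (X n t + of_real c * B n t) < M}" for c
  have sec1: "Pair c -` S = E c" if "c \<in> {1..2}" for c
    using that unfolding S_def E_def by auto
  have Es: "E c \<in> sets lborel" if "c \<in> {1..2}" for c
    using sets_Pair1[OF S, of c] sec1[OF that] by simp
  have "\<exists>c\<in>{1..2}. emeasure lborel (E c) \<le> ennreal e"
  proof (rule ccontr)
    assume neg: "\<not> ?thesis"
    \<comment> \<open>The parameter interval has length 1, so no normalising factor appears.\<close>
    have "ennreal e = (\<integral>\<^sup>+c. ennreal e * indicator {1..2::real} c \<partial>lborel)"
      by (subst nn_integral_cmult_indicator) auto
    also have "\<dots> \<le> (\<integral>\<^sup>+c. emeasure lborel (Pair c -` S) \<partial>lborel)"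
    proof (rule nn_integral_mono)
      fix c :: real
      show "ennreal e * indicator {1..2} c \<le> emeasure lborel (Pair c -` S)"
      proof (cases "c \<in> {1..2}")
        case True
        then have "\<not> emeasure lborel (E c) \<le> ennreal e" using neg by blast
        then show ?thesis using True sec1[OF True] by simp
      qed simp
    qed
    also have "\<dots> = emeasure (lborel \<Otimes>\<^sub>M lborel) S"
      by (rule lborel.emeasure_pair_measure_alt[OF S, symmetric])
    also have "\<dots> = (\<integral>\<^sup>+t. emeasure lborel ((\<lambda>c. (c, t)) -` S) \<partial>lborel)"
      by (rule lborel_pair.emeasure_pair_measure_alt2[OF S])
    also have "\<dots> \<le> (\<integral>\<^sup>+t. ennreal \<kappa> * indicator {0..2*pi} t \<partial>lborel)"
    proof (rule nn_integral_mono)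
      fix t :: real
      show "emeasure lborel ((\<lambda>c. (c, t)) -` S) \<le> ennreal \<kappa> * indicator {0..2*pi} t"
      proof (cases "t \<in> {0..2*pi}")
        case True
        have "(\<lambda>c. (c, t)) -` S = (\<Union>n\<in>I. {c\<in>{1..2}. cmod (X n t + of_real c * B n t) < M})"
          using True unfolding S_def by auto
        also have "emeasure lborel \<dots> \<le> (\<Sum>n\<in>I. emeasure lborel {c\<in>{1..2}. cmod (X n t + of_real c * B n t) < M})"
        proof (intro emeasure_subadditive_finite assms image_subsetI)
          fix n
          have "{c\<in>{1..2}. cmod (X n t + of_real c * B n t) < M}
              = {1..2} \<inter> {c. cmod (X n t + of_real c * B n t) < M}" by blast
          also have "\<dots> \<in> sets lborel"
            unfolding sets_lborel
            by (intro sets.Int borel_open borel_closed closed_atLeastAtMost open_Collect_less continuous_intros)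
          finally show "{c\<in>{1..2}. cmod (X n t + of_real c * B n t) < M} \<in> sets lborel" .
        qed
        also have "\<dots> \<le> (\<Sum>n\<in>I. ennreal (4 * M / b n))"
          by (intro sum_mono emeasure_parameter_near_zero_le b M)
        also have "\<dots> = ennreal \<kappa>"
          unfolding \<kappa>_def using b M by (intro sum_ennreal) (auto intro: less_imp_le)
        finally show ?thesis using True by simp
      next
        case False
        then have "(\<lambda>c. (c, t)) -` S = {}" unfolding S_def by auto
        then show ?thesis by (simp only: emeasure_empty zero_le)
      qed
    qed
    also have "\<dots> = ennreal (\<kappa> * (2 * pi))"
      using \<kappa> by (subst nn_integral_cmult_indicator) (auto simp: ennreal_mult)
    finally have "e \<le> \<kappa> * (2 * pi)" using ennreal_le_iff[of "\<kappa> * (2 * pi)" e] \<kappa> by simp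
    then show False using e unfolding \<kappa>_def by simp
  qed
  then obtain c where c: "c \<in> {1..2}" "emeasure lborel (E c) \<le> ennreal e" by blast
  show thesis
    using that[OF c(1)] Es[OF c(1)] c(2) unfolding E_def by simp
qed

text \<open>One step of the construction: \<open>P\<close> is added to \<open>F\<close> so as to
  reach a target on the circle of radius \<open>r\<close> without disturbing the smaller disc or the
  coefficients below \<open>m\<close>. The exceptional set takes in all \<open>n \<ge> m\<close>,
  although only those up to the next block will matter.\<close>

lemma universal_block:
  fixes F :: "complex poly"
  assumes K: "compact K" "K \<subseteq> sphere 0 1" "K \<noteq> sphere 0 1" and \<phi>: "continuous_on K \<phi>"
    and x: "0 \<le> x" "x < r" "r < 1" and M: "M > 0" and e: "e > 0"
  obtains m P where "m \<ge> N" "\<And>i. i < m \<Longrightarrow> coeff P i = 0"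
    "\<And>z. cmod z \<le> x \<Longrightarrow> cmod (poly P z) \<le> e"
    "\<And>z. z \<in> K \<Longrightarrow> cmod (poly (F + P) (of_real r * z) - \<phi> z) \<le> e"
    "{t\<in>{0..2*pi}. \<exists>n\<ge>m. cmod (\<Sum>i\<le>n. coeff (F + P) i * cis t ^ i) < M} \<in> sets lborel"
    "emeasure lborel {t\<in>{0..2*pi}. \<exists>n\<ge>m. cmod (\<Sum>i\<le>n. coeff (F + P) i * cis t ^ i) < M} \<le> ennreal e"
proof -
  \<comment> \<open>This makes \<open>s * r\<close> the midpoint of \<open>r\<close> and 1: the
    geometric block grows on the unit circle and decays on the disc of radius
    \<open>r\<close>.\<close>
  define s where "s = (1 + r) / (2 * r)"
  have r: "r > 0" using x by simp
  have s: "s > 1" unfolding s_def using r x by (simp add: field_simps)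
  have sr: "s * r = (1 + r) / 2" "0 < s * r" "s * r < 1" unfolding s_def using r x by auto
  \<comment> \<open>\<open>C * (1/s) ^ m\<close> bounds \<open>2 * pi\<close> times the sum of
    \<open>4 * M / b n\<close> over \<open>n \<ge> m\<close>, with \<open>b n\<close> the lower
    bound from \<open>norm_geometric_sum_ge\<close>.\<close>
  define C where "C = 4 * M * (s + 1) / (s - 1) * (s / (s - 1)) * (2 * pi)"
  \<comment> \<open>The 2 is the largest value of the parameter \<open>c\<close>; the rest bounds
    the geometric block on the disc of radius \<open>r\<close>.\<close>
  have "(\<lambda>m. 2 / (1 - s * r) * (s * r) ^ m) \<longlonglongrightarrow> 2 / (1 - s * r) * 0"
    by (intro tendsto_intros LIMSEQ_realpow_zero) (use sr in auto)
  then have ev1: "eventually (\<lambda>m. 2 / (1 - s * r) * (s * r) ^ m < e/2) sequentially"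
    using e by (intro order_tendstoD(2)[where y = "2 / (1 - s * r) * 0"]) auto
  have "(\<lambda>m. C * (1/s) ^ m) \<longlonglongrightarrow> C * 0"
    by (intro tendsto_intros LIMSEQ_realpow_zero) (use s in auto)
  then have ev2: "eventually (\<lambda>m. C * (1/s) ^ m < e) sequentially"
    using e by (intro order_tendstoD(2)[where y = "C * 0"]) auto
  obtain m where m: "m \<ge> N" "2 / (1 - s * r) * (s * r) ^ m < e/2" "C * (1/s) ^ m < e"
    using eventually_conj[OF eventually_ge_at_top[of N] eventually_conj[OF ev1 ev2]]
    unfolding eventually_sequentially by blast
  have "continuous_on K (\<lambda>z. \<phi> z - poly F (of_real r * z))"
    by (intro continuous_intros \<phi>)
  from polynomial_approximation_arc_disc[OF K x(1,2) this half_gt_zero[OF e], of m]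
  obtain q where q: "\<And>z. cmod z \<le> x \<Longrightarrow> cmod (z ^ m * poly q z) < e/2"
    "\<And>z. z \<in> K \<Longrightarrow> cmod ((of_real r * z) ^ m * poly q (of_real r * z) - (\<phi> z - poly F (of_real r * z))) < e/2" by blast
  define A where "A = monom 1 m * q"
  have A: "poly A z = z ^ m * poly q z" for z unfolding A_def by (simp add: poly_monom)
  \<comment> \<open>Neither \<open>F + A\<close> nor the geometric block has terms beyond
    \<open>L\<close>, so the partial sums are constant from there on and only the finitely many
    \<open>n\<close> in \<open>{m..L}\<close> have to be controlled. The maximum keeps this range
    nonempty.\<close>
  define L where "L = max m (degree (F + A))"
  define X where "X n t = (\<Sum>i\<le>n. coeff (F + A) i * cis t ^ i)" for n t
  define B where "B n t = (\<Sum>i=m..n. (of_real s * cis t) ^ i)" for n t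
  define b where "b n = s ^ n * (s - 1) / (s + 1)" for n
  have b0: "b n > 0" for n unfolding b_def using s by auto
  have bB: "b n \<le> cmod (B n t)" if "n \<in> {m..L}" for n t
    unfolding b_def B_def using that s by (intro norm_geometric_sum_ge) auto
  have sb: "(\<Sum>n=m..L. 4 * M / b n) * (2 * pi) < e"
  proof -
    have "(\<Sum>n=m..L. (1/s) ^ n) \<le> (1/s) ^ m * (s / (s - 1))"
    proof -
      have "(\<Sum>n=m..L. (1/s) ^ n) = ((1/s) ^ m - (1/s) ^ Suc L) / (1 - 1/s)"
        using s by (subst sum_gp) (auto simp: L_def)
      also have "\<dots> \<le> (1/s) ^ m / (1 - 1/s)" using s by (intro divide_right_mono) auto
      also have "\<dots> = (1/s) ^ m * (s / (s - 1))" using s by (simp add: field_simps)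
      finally show ?thesis .
    qed
    then have "4 * M * (s + 1) / (s - 1) * (\<Sum>n=m..L. (1/s) ^ n) * (2 * pi)
        \<le> 4 * M * (s + 1) / (s - 1) * ((1/s) ^ m * (s / (s - 1))) * (2 * pi)"
      using s M by (intro mult_right_mono mult_left_mono) auto
    also have "\<dots> = C * (1/s) ^ m" unfolding C_def by simp
    also have "4 * M * (s + 1) / (s - 1) * (\<Sum>n=m..L. (1/s) ^ n) = (\<Sum>n=m..L. 4 * M / b n)"
      unfolding sum_distrib_left b_def by (intro sum.cong refl) (use s in \<open>simp add: field_simps\<close>)
    finally show ?thesis using m(3) by simp
  qed
  have cX: "continuous_on UNIV (X n)" and cB: "continuous_on UNIV (B n)" for n
    unfolding X_def B_def by (intro continuous_intros)+
  obtain c :: real where c: "c \<in> {1..2}"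
    "{t\<in>{0..2*pi}. \<exists>n\<in>{m..L}. cmod (X n t + of_real c * B n t) < M} \<in> sets lborel"
    "emeasure lborel {t\<in>{0..2*pi}. \<exists>n\<in>{m..L}. cmod (X n t + of_real c * B n t) < M} \<le> ennreal e"
    by (rule exists_parameter_small_bad_set[OF finite_atLeastAtMost cX cB b0 bB M sb])
  define G where "G = (\<Sum>i=m..L. monom (complex_of_real s ^ i) i)"
  define P where "P = A + smult (of_real c) G"
  have cG: "coeff G i = (if i \<in> {m..L} then of_real s ^ i else 0)" for i
    unfolding G_def by (simp add: coeff_sum)
  have cA: "coeff A i = 0" if "i < m" for i
    unfolding A_def using that by (simp add: coeff_monom_mult)
  have G: "cmod (poly G z) \<le> (s * r) ^ m / (1 - s * r)" if "cmod z \<le> r" for z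
  proof -
    have "cmod (poly G z) \<le> (\<Sum>i=m..L. cmod (of_real s ^ i * z ^ i))"
      unfolding G_def poly_sum poly_monom by (rule norm_sum)
    also have "\<dots> \<le> (\<Sum>i=m..L. (s * r) ^ i)"
      unfolding power_mult_distrib[symmetric] norm_power
      using s that by (intro sum_mono power_mono) (auto simp: norm_mult)
    also have "\<dots> = ((s * r) ^ m - (s * r) ^ Suc L) / (1 - s * r)"
      using sr by (subst sum_gp) (auto simp: L_def)
    also have "\<dots> \<le> (s * r) ^ m / (1 - s * r)" using sr by (intro divide_right_mono) auto
    finally show ?thesis .
  qed
  have cGe: "cmod (of_real c * poly G z) \<le> e/2" if "cmod z \<le> r" for z
  proof -
    have "cmod (of_real c * poly G z) \<le> 2 * ((s * r) ^ m / (1 - s * r))"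
      unfolding norm_mult using c(1) G[OF that] by (intro mult_mono) auto
    then show ?thesis using m(2) by simp
  qed
  \<comment> \<open>Replacing \<open>n\<close> by \<open>min n L\<close> reduces the infinitely many
    partial sums to those in the parameter lemma.\<close>
  have sumFP: "(\<Sum>i\<le>n. coeff (F + P) i * cis t ^ i) = X (min n L) t + of_real c * B (min n L) t"
    if "n \<ge> m" for n t
  proof -
    have "(\<Sum>i\<le>n. coeff (F + P) i * cis t ^ i) = (\<Sum>i\<le>min n L. coeff (F + P) i * cis t ^ i)"
    proof (rule sum.mono_neutral_right)
      show "\<forall>i\<in>{..n} - {..min n L}. coeff (F + P) i * cis t ^ i = 0"
      proof
        fix i assume "i \<in> {..n} - {..min n L}"
        then have "i > L" by auto
        then have "coeff (F + A) i = 0" by (intro coeff_eq_0) (simp add: L_def)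
        moreover have "coeff G i = 0" using \<open>i > L\<close> cG by simp
        ultimately show "coeff (F + P) i * cis t ^ i = 0" unfolding P_def by simp
      qed
    qed auto
    also have "\<dots> = X (min n L) t + of_real c * (\<Sum>i\<le>min n L. coeff G i * cis t ^ i)"
      unfolding X_def P_def sum_distrib_left sum.distrib[symmetric]
      by (intro sum.cong) (auto simp: algebra_simps)
    also have "(\<Sum>i\<le>min n L. coeff G i * cis t ^ i) = (\<Sum>i=m..min n L. coeff G i * cis t ^ i)"
      by (rule sum.mono_neutral_right) (auto simp: cG)
    also have "\<dots> = B (min n L) t"
      unfolding B_def by (intro sum.cong) (auto simp: cG power_mult_distrib)
    finally show ?thesis .
  qed
  have seteq: "{t\<in>{0..2*pi}. \<exists>n\<ge>m. cmod (\<Sum>i\<le>n. coeff (F + P) i * cis t ^ i) < M}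
      = {t\<in>{0..2*pi}. \<exists>n\<in>{m..L}. cmod (X n t + of_real c * B n t) < M}"
  proof (intro Collect_cong conj_cong refl iffI)
    fix t assume "\<exists>n\<ge>m. cmod (\<Sum>i\<le>n. coeff (F + P) i * cis t ^ i) < M"
    then obtain n where n: "n \<ge> m" "cmod (X (min n L) t + of_real c * B (min n L) t) < M"
      using sumFP by auto
    then show "\<exists>n\<in>{m..L}. cmod (X n t + of_real c * B n t) < M"
      by (intro bexI[of _ "min n L"]) (auto simp: L_def)
  next
    fix t assume "\<exists>n\<in>{m..L}. cmod (X n t + of_real c * B n t) < M"
    then obtain n where n: "n \<in> {m..L}" "cmod (X n t + of_real c * B n t) < M" by blast
    then show "\<exists>n\<ge>m. cmod (\<Sum>i\<le>n. coeff (F + P) i * cis t ^ i) < M"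
      using sumFP[of n t] by (intro exI[of _ n]) (auto simp: min_def)
  qed
  show thesis
  proof (rule that[of m P])
    show "m \<ge> N" by (rule m)
    show "coeff P i = 0" if "i < m" for i
      unfolding P_def using cA[OF that] cG that by simp
    show "cmod (poly P z) \<le> e" if "cmod z \<le> x" for z
      using norm_triangle_ineq[of "poly A z" "of_real c * poly G z"] q(1)[OF that] cGe[of z] that x
      unfolding P_def by (simp add: A)
    show "cmod (poly (F + P) (of_real r * z) - \<phi> z) \<le> e" if "z \<in> K" for z
    proof -
      let ?w = "of_real r * z"
      have "cmod ?w \<le> r" using K(2) that r by (auto simp: norm_mult)
      then have 1: "cmod (of_real c * poly G ?w) \<le> e/2" by (rule cGe)
      have 2: "cmod (poly A ?w - (\<phi> z - poly F ?w)) < e/2"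
        unfolding A by (rule q(2)[OF that])
      have "poly (F + P) ?w - \<phi> z = (poly A ?w - (\<phi> z - poly F ?w)) + of_real c * poly G ?w"
        unfolding P_def poly_add poly_smult by simp
      also have "cmod \<dots> \<le> cmod (poly A ?w - (\<phi> z - poly F ?w)) + cmod (of_real c * poly G ?w)"
        by (rule norm_triangle_ineq)
      finally show ?thesis using 1 2 by linarith
    qed
    show "{t\<in>{0..2*pi}. \<exists>n\<ge>m. cmod (\<Sum>i\<le>n. coeff (F + P) i * cis t ^ i) < M} \<in> sets lborel"
      unfolding seteq by (rule c(2))
    show "emeasure lborel {t\<in>{0..2*pi}. \<exists>n\<ge>m. cmod (\<Sum>i\<le>n. coeff (F + P) i * cis t ^ i) < M} \<le> ennreal e"
      unfolding seteq by (rule c(3))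
  qed
qed

section \<open>Abel universality\<close>

lemma higher_deriv_poly_0: "(deriv ^^ n) (poly p) 0 = fact n * coeff p n"
  for p :: "complex poly"
proof -
  have "deriv (poly q) = poly (pderiv q)" for q :: "complex poly"
    by (rule ext, rule DERIV_imp_deriv, rule poly_DERIV)
  then have "(deriv ^^ n) (poly p) = poly ((pderiv ^^ n) p)"
    by (induction n) auto
  then show ?thesis
    by (simp add: poly_0_coeff_0 coeff_higher_pderiv pochhammer_fact)
qed

section \<open>A countable family of targets\<close>

text \<open>A countable dense set \<open>D\<close> supplies both the centres of the balls cut out of
  the circle and the coefficients of the target polynomials. Polynomials suffice as targets by
  \<open>poly_approximable_arc\<close>. Each pair must recur infinitely often, since the errors in
  the construction shrink only with the index.\<close>

lemma dense_sequence_on_arcs: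
  obtains T :: "nat \<Rightarrow> complex set \<times> complex poly" where
    "\<And>k. compact (fst (T k)) \<and> fst (T k) \<subseteq> sphere 0 1 \<and> fst (T k) \<noteq> sphere 0 1"
    "\<And>K \<phi> \<epsilon> N. compact K \<Longrightarrow> K \<subseteq> sphere 0 1 \<Longrightarrow> K \<noteq> sphere 0 1 \<Longrightarrow> continuous_on K \<phi> \<Longrightarrow> \<epsilon> > 0 \<Longrightarrow>
      \<exists>k\<ge>N. K \<subseteq> fst (T k) \<and> (\<forall>z\<in>K. cmod (poly (snd (T k)) z - \<phi> z) < \<epsilon>)"
proof -
  obtain D :: "complex set" where D: "countable D" "\<And>X. open X \<Longrightarrow> X \<noteq> {} \<Longrightarrow> \<exists>d\<in>D. d \<in> X"
    using countable_dense_exists[where 'a = complex] by blast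
  define arc where "arc d n = sphere 0 1 - ball d (1 / real (Suc n))" for d :: complex and n
  define pol where "pol l = (\<Sum>i<length l. monom (l ! i) i)" for l :: "complex list"
  \<comment> \<open>The filter discards balls that miss the circle.\<close>
  define \<T> where "\<T> = {a \<in> (\<lambda>(d, n, l). (arc d n, pol l)) ` (D \<times> UNIV \<times> lists D). fst a \<noteq> sphere 0 1}"
  have cT: "countable \<T>"
    unfolding \<T>_def
    by (intro countable_Collect countable_image countable_SIGMA countable_lists D) auto
  have approx: "\<exists>a\<in>\<T>. K \<subseteq> fst a \<and> (\<forall>z\<in>K. cmod (poly (snd a) z - \<phi> z) < \<epsilon>)"
    if K: "compact K" "K \<subseteq> sphere 0 1" "K \<noteq> sphere 0 1" and \<phi>: "continuous_on K \<phi>" and \<epsilon>: "\<epsilon> > 0"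
    for K :: "complex set" and \<phi> :: "complex \<Rightarrow> complex" and \<epsilon> :: real
  proof -
    obtain g where g: "g \<in> sphere 0 1" "g \<notin> K" using K(2,3) by blast
    obtain e where e: "e > 0" "\<And>z. z \<in> K \<Longrightarrow> e \<le> dist g z"
      using separate_point_closed[of K g] K(1) g(2) compact_imp_closed by blast
    obtain n where n: "1 / real (Suc n) < e / 2"
      using nat_approx_posE[of "e/2"] e(1) by auto
    obtain d where d: "d \<in> D" "d \<in> ball g (1 / real (Suc n))"
      using D(2)[of "ball g (1 / real (Suc n))"] by auto
    have 1: "K \<subseteq> arc d n"
    proof
      fix z assume z: "z \<in> K"
      have "dist g z \<le> dist g d + dist d z" by (rule dist_triangle)
      then have "dist d z \<ge> 1 / real (Suc n)" using d(2) n e(2)[OF z] unfolding mem_ball by linarith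
      then show "z \<in> arc d n" using z K(2) unfolding arc_def by auto
    qed
    have 2: "arc d n \<noteq> sphere 0 1"
    proof -
      have "g \<notin> arc d n" using d(2) unfolding arc_def by (simp add: dist_commute)
      then show ?thesis using g(1) by blast
    qed
    obtain p where p: "\<And>z. z \<in> K \<Longrightarrow> cmod (poly p z - \<phi> z) < \<epsilon>/2"
      using poly_approximableD[OF poly_approximable_arc[OF K(1,2) g \<phi>], of "\<epsilon>/2"] \<epsilon> by auto
    \<comment> \<open>On the unit circle the \<open>degree p + 1\<close> coefficient errors then add
      up to at most \<open>\<epsilon> / 2\<close>.\<close>
    define \<delta> where "\<delta> = \<epsilon> / 2 / real (Suc (degree p))"
    have \<delta>: "\<delta> > 0" unfolding \<delta>_def using \<epsilon> by simp
    have "\<exists>d. d \<in> D \<and> d \<in> ball (coeff p i) \<delta>" for i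
      using D(2)[of "ball (coeff p i) \<delta>"] \<delta> by auto
    then obtain c where c: "\<And>i. c i \<in> D" "\<And>i. c i \<in> ball (coeff p i) \<delta>"
      using choice[of "\<lambda>i d. d \<in> D \<and> d \<in> ball (coeff p i) \<delta>"] by blast
    define l where "l = map c [0..<Suc (degree p)]"
    have l: "l \<in> lists D" unfolding l_def using c(1) by auto
    have pol: "poly (pol l) z = (\<Sum>i\<le>degree p. c i * z ^ i)" for z
      unfolding pol_def l_def poly_sum poly_monom
      by (intro sum.cong) (auto simp del: upt_Suc simp: less_Suc_eq_le)
    have 3: "cmod (poly (pol l) z - \<phi> z) < \<epsilon>" if z: "z \<in> K" for z
    proof -
      have z1: "cmod z = 1" using z K(2) by auto
      have "cmod (poly (pol l) z - poly p z) = cmod (\<Sum>i\<le>degree p. (c i - coeff p i) * z ^ i)"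
        unfolding pol poly_altdef[of p] by (simp add: sum_subtractf left_diff_distrib)
      also have "\<dots> \<le> (\<Sum>i\<le>degree p. \<delta>)"
      proof (rule sum_norm_le)
        fix i show "cmod ((c i - coeff p i) * z ^ i) \<le> \<delta>"
          using c(2)[of i] z1 by (simp add: norm_mult norm_power dist_norm norm_minus_commute)
      qed
      also have "\<dots> = \<epsilon> / 2" unfolding \<delta>_def by (simp add: field_simps)
      finally have "cmod (poly (pol l) z - poly p z) \<le> \<epsilon> / 2" .
      then show ?thesis
        using p[OF z] norm_triangle_ineq[of "poly (pol l) z - poly p z" "poly p z - \<phi> z"] by simp
    qed
    have "(arc d n, pol l) \<in> \<T>"
      unfolding \<T>_def
    proof (intro CollectI conjI)
      show "(arc d n, pol l) \<in> (\<lambda>(d, n, l). (arc d n, pol l)) ` (D \<times> UNIV \<times> lists D)"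
        by (rule image_eqI[of _ _ "(d, n, l)"]) (use d(1) l in simp_all)
    qed (use 2 in simp)
    then show ?thesis
      by (rule bexI[rotated]) (use 1 3 in simp)
  qed
  have "\<T> \<noteq> {}"
  proof -
    have "(1::complex) \<in> sphere 0 1" by simp
    then have "{} \<noteq> sphere (0::complex) 1" by (metis empty_iff)
    then show ?thesis using approx[of "{}" "\<lambda>_. 0" 1] by auto
  qed
  then have range: "range (from_nat_into \<T>) = \<T>"
    by (rule range_from_nat_into[OF _ cT])
  show thesis
  \<comment> \<open>The second component of the decoded pair is ignored, which repeats each target;
    \<open>prod_encode (j, N)\<close> is an occurrence of target \<open>j\<close> at an index at
    least \<open>N\<close>.\<close>
  proof (rule that[of "\<lambda>k. from_nat_into \<T> (fst (prod_decode k))"])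
    fix k
    have "from_nat_into \<T> (fst (prod_decode k)) \<in> \<T>" by (rule from_nat_into[OF \<open>\<T> \<noteq> {}\<close>])
    then show "compact (fst (from_nat_into \<T> (fst (prod_decode k)))) \<and>
         fst (from_nat_into \<T> (fst (prod_decode k))) \<subseteq> sphere 0 1 \<and>
         fst (from_nat_into \<T> (fst (prod_decode k))) \<noteq> sphere 0 1"
      unfolding \<T>_def arc_def by (auto intro!: compact_diff)
  next
    fix K :: "complex set" and \<phi> :: "complex \<Rightarrow> complex" and \<epsilon> :: real and N :: nat
    assume "compact K" "K \<subseteq> sphere 0 1" "K \<noteq> sphere 0 1" "continuous_on K \<phi>" "\<epsilon> > 0"
    then obtain a where a: "a \<in> \<T>" "K \<subseteq> fst a" "\<forall>z\<in>K. cmod (poly (snd a) z - \<phi> z) < \<epsilon>"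
      using approx by blast
    obtain j where j: "from_nat_into \<T> j = a" using a(1) range by (metis rangeE)
    show "\<exists>k\<ge>N. K \<subseteq> fst (from_nat_into \<T> (fst (prod_decode k))) \<and>
         (\<forall>z\<in>K. cmod (poly (snd (from_nat_into \<T> (fst (prod_decode k)))) z - \<phi> z) < \<epsilon>)"
      by (rule exI[of _ "prod_encode (j, N)"]) (use a j in \<open>auto simp: le_prod_encode_2\<close>)
  qed
qed

section \<open>Limits of telescoping sequences\<close>

text \<open>The bound is the exact value of the finite geometric sum from \<open>k\<close> to
  \<open>l - 1\<close>; the subtracted term lets the induction close.\<close>

lemma telescoping_halves_bound:
  fixes u :: "nat \<Rightarrow> complex"
  assumes "\<And>l. l \<ge> k \<Longrightarrow> cmod (u (Suc l) - u l) \<le> (1/2) ^ l" "k \<le> l"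
  shows "cmod (u l - u k) \<le> 2 * (1/2) ^ k - 2 * (1/2) ^ l"
  using assms(2)
proof (induction l rule: dec_induct)
  case (step l)
  have "cmod (u (Suc l) - u k) \<le> cmod (u (Suc l) - u l) + cmod (u l - u k)"
    using norm_triangle_ineq[of "u (Suc l) - u l" "u l - u k"] by simp
  then show ?case using step assms(1)[of l] by simp
qed simp

lemma telescoping_halves_diff_le:
  fixes u :: "nat \<Rightarrow> complex"
  assumes "\<And>l. l \<ge> k \<Longrightarrow> cmod (u (Suc l) - u l) \<le> (1/2) ^ l" "k \<le> l" "l \<le> l'"
  shows "cmod (u l' - u l) \<le> 2 * (1/2) ^ l"
proof -
  have "cmod (u l' - u l) \<le> 2 * (1/2) ^ l - 2 * (1/2) ^ l'"
    by (rule telescoping_halves_bound) (use assms in auto)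
  moreover have "0 \<le> (1/2::real) ^ l'" by simp
  ultimately show ?thesis by linarith
qed

lemma telescoping_halves_convergent:
  fixes u :: "nat \<Rightarrow> complex"
  assumes u: "\<And>l. l \<ge> k \<Longrightarrow> cmod (u (Suc l) - u l) \<le> (1/2) ^ l"
  shows "convergent u"
proof (intro Cauchy_convergent CauchyI')
  fix e :: real assume "e > 0"
  have "(\<lambda>l. 2 * (1/2) ^ l) \<longlonglongrightarrow> 2 * (0::real)"
    by (intro tendsto_intros LIMSEQ_realpow_zero) auto
  then have "eventually (\<lambda>l. 2 * (1/2) ^ l < e) sequentially"
    using \<open>e > 0\<close> by (intro order_tendstoD(2)[where y = "2 * 0"]) auto
  then obtain M where M: "\<And>l. l \<ge> M \<Longrightarrow> 2 * (1/2) ^ l < e"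
    unfolding eventually_sequentially by blast
  have "cmod (u m - u n) < e" if mn: "max k M \<le> m" "m < n" for m n
  proof -
    have "cmod (u n - u m) \<le> 2 * (1/2) ^ m"
      by (rule telescoping_halves_diff_le[OF u]) (use mn in auto)
    then show ?thesis using M[of m] mn by (simp add: norm_minus_commute)
  qed
  then show "\<exists>M. \<forall>m\<ge>M. \<forall>n>m. dist (u m) (u n) < e"
    unfolding dist_norm by blast
qed

lemma telescoping_halves_limit:
  fixes u :: "nat \<Rightarrow> complex"
  assumes u: "\<And>l. l \<ge> k \<Longrightarrow> cmod (u (Suc l) - u l) \<le> (1/2) ^ l" and l: "k \<le> l"
  shows "cmod (lim u - u l) \<le> 2 * (1/2) ^ l"
proof (rule Lim_bounded[of _ _ l])
  show "(\<lambda>l'. cmod (u l' - u l)) \<longlonglongrightarrow> cmod (lim u - u l)"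
    using telescoping_halves_convergent[OF u]
    by (intro tendsto_intros) (simp add: convergent_LIMSEQ_iff)
  show "\<forall>l'\<ge>l. cmod (u l' - u l) \<le> 2 * (1/2) ^ l"
    using telescoping_halves_diff_le[OF u l] by blast
qed

lemma exists_strict_mono_uniform_limit:
  fixes g :: "nat \<Rightarrow> complex \<Rightarrow> complex"
  assumes "\<And>\<epsilon> N. \<epsilon> > 0 \<Longrightarrow> \<exists>n>N. \<forall>z\<in>K. cmod (g n z - \<phi> z) < \<epsilon>"
  shows "\<exists>s. strict_mono s \<and> uniform_limit K (\<lambda>k. g (s k)) \<phi> sequentially"
proof -
  have "\<exists>s. \<forall>l. (\<forall>z\<in>K. cmod (g (s l) z - \<phi> z) < 1 / real (Suc l)) \<and> s l < s (Suc l)"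
  proof (rule dependent_nat_choice)
    show "\<exists>x. \<forall>z\<in>K. cmod (g x z - \<phi> z) < 1 / real (Suc 0)"
      using assms[of "1 / real (Suc 0)" 0] by auto
    show "\<exists>y. (\<forall>z\<in>K. cmod (g y z - \<phi> z) < 1 / real (Suc (Suc n))) \<and> x < y" for x n
      using assms[of "1 / real (Suc (Suc n))" x] by auto
  qed
  then obtain s where s: "\<And>l z. z \<in> K \<Longrightarrow> cmod (g (s l) z - \<phi> z) < 1 / real (Suc l)" "\<And>l. s l < s (Suc l)"
    by blast
  have "uniform_limit K (\<lambda>k. g (s k)) \<phi> sequentially"
    unfolding uniform_limit_sequentially_iff
  proof (intro allI impI)
    fix e :: real assume "e > 0"
    then obtain N where N: "1 / real (Suc N) < e" using nat_approx_posE by blast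
    have "dist (g (s n) z) (\<phi> z) < e" if "n \<ge> N" "z \<in> K" for n z
    proof -
      have "1 / real (Suc n) \<le> 1 / real (Suc N)" using that by (intro divide_left_mono) auto
      then show ?thesis using s(1)[OF that(2), of n] N unfolding dist_norm by linarith
    qed
    then show "\<exists>N. \<forall>n\<ge>N. \<forall>z\<in>K. dist (g (s n) z) (\<phi> z) < e" by blast
  qed
  then show ?thesis using s(2) strict_mono_Suc_iff by blast
qed

section \<open>The inductive construction and its limit\<close>

theorem theorem4p10:
  fixes \<rho> :: "nat \<Rightarrow> real"
  assumes "incseq \<rho>"
    and "\<And>n. 0 \<le> \<rho> n \<and> \<rho> n < 1"
    and "\<rho> \<longlonglongrightarrow> 1"
  shows "\<exists>f \<in> U_A \<rho>. AE t in lborel. t \<in> {0..2*pi} \<longrightarrow>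
           filterlim (\<lambda>n. partial_sum f n (cis t)) at_infinity sequentially"
proof -
  obtain T :: "nat \<Rightarrow> complex set \<times> complex poly" where
    T: "\<And>k. compact (fst (T k)) \<and> fst (T k) \<subseteq> sphere 0 1 \<and> fst (T k) \<noteq> sphere 0 1"
    "\<And>K \<phi> \<epsilon> N. compact K \<Longrightarrow> K \<subseteq> sphere 0 1 \<Longrightarrow> K \<noteq> sphere 0 1 \<Longrightarrow> continuous_on K \<phi> \<Longrightarrow> \<epsilon> > 0 \<Longrightarrow>
      \<exists>k\<ge>N. K \<subseteq> fst (T k) \<and> (\<forall>z\<in>K. cmod (poly (snd (T k)) z - \<phi> z) < \<epsilon>)"
    using dense_sequence_on_arcs by blast
  \<comment> \<open>The threshold \<open>k + 1\<close> tends to infinity and is positive already at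
    \<open>k = 0\<close>, as \<open>universal_block\<close> requires.\<close>
  define bad where "bad k m F = {t\<in>{0..2*pi}. \<exists>n\<ge>m. cmod (\<Sum>i\<le>n. coeff F i * cis t ^ i) < real (Suc k)}"
    for k m and F :: "complex poly"
  \<comment> \<open>A state holds the index in \<open>\<rho>\<close> of the current radius, the
    current polynomial and the degree at which its last block starts. Step \<open>k\<close> protects
    the disc of the old radius and meets target \<open>T k\<close> at the new one.\<close>
  define succ_state where "succ_state k st st' \<longleftrightarrow> (case st of (n, F, m) \<Rightarrow> case st' of (n', F', m') \<Rightarrow>
      n < n' \<and> m < m' \<and> (\<forall>i<m'. coeff F' i = coeff F i) \<and>
      (\<forall>z. cmod z \<le> \<rho> n \<longrightarrow> cmod (poly F' z - poly F z) \<le> (1/2) ^ k) \<and>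
      (\<forall>z\<in>fst (T k). cmod (poly F' (of_real (\<rho> n') * z) - poly (snd (T k)) z) \<le> (1/2) ^ k) \<and>
      bad k m' F' \<in> sets lborel \<and> emeasure lborel (bad k m' F') \<le> ennreal ((1/2) ^ k))"
    for k and st st' :: "nat \<times> complex poly \<times> nat"
  \<comment> \<open>Every triple has a successor, so the invariant is trivial.\<close>
  have "\<exists>f. \<forall>k. True \<and> succ_state k (f k) (f (Suc k))"
  proof (rule dependent_nat_choice)
    fix st :: "nat \<times> complex poly \<times> nat" and k
    obtain n F m where st: "st = (n, F, m)" by (cases st) auto
    have "eventually (\<lambda>n'. \<rho> n < \<rho> n') sequentially"
      using assms(3) assms(2)[of n] by (intro order_tendstoD(1)[of \<rho> 1]) auto
    then obtain n' where n': "\<rho> n < \<rho> n'" unfolding eventually_sequentially by blast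
    then have "n < n'" using assms(1) by (metis incseqD not_less)
    have poly_cont: "continuous_on (fst (T k)) (poly (snd (T k)))" by (intro continuous_intros)
    have pos: "real (Suc k) > 0" "(1/2) ^ k > (0::real)" by auto
    obtain m' P where "m' \<ge> Suc (max m (degree F))" "\<And>i. i < m' \<Longrightarrow> coeff P i = 0"
      "\<And>z. cmod z \<le> \<rho> n \<Longrightarrow> cmod (poly P z) \<le> (1/2) ^ k"
      "\<And>z. z \<in> fst (T k) \<Longrightarrow> cmod (poly (F + P) (of_real (\<rho> n') * z) - poly (snd (T k)) z) \<le> (1/2) ^ k"
      "bad k m' (F + P) \<in> sets lborel"
      "emeasure lborel (bad k m' (F + P)) \<le> ennreal ((1/2) ^ k)"
      by (rule universal_block[OF T(1)[of k, THEN conjunct1] T(1)[of k, THEN conjunct2, THEN conjunct1]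
          T(1)[of k, THEN conjunct2, THEN conjunct2] poly_cont assms(2)[of n, THEN conjunct1] n'
          assms(2)[of n', THEN conjunct2] pos, of "Suc (max m (degree F))" F, folded bad_def])
        (rule that)
    then show "\<exists>y. True \<and> succ_state k st y"
      unfolding succ_state_def st using \<open>n < n'\<close> by (intro exI[of _ "(n', F + P, m')"]) simp
  qed simp
  then obtain st where st: "\<And>k. succ_state k (st k) (st (Suc k))" by blast
  define \<nu> F m where "\<nu> k = fst (st k)" and "F k = fst (snd (st k))" and "m k = snd (snd (st k))" for k
  have step: "\<nu> k < \<nu> (Suc k)" "m k < m (Suc k)" "i < m (Suc k) \<Longrightarrow> coeff (F (Suc k)) i = coeff (F k) i"
    "cmod z \<le> \<rho> (\<nu> k) \<Longrightarrow> cmod (poly (F (Suc k)) z - poly (F k) z) \<le> (1/2) ^ k"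
    "z \<in> fst (T k) \<Longrightarrow> cmod (poly (F (Suc k)) (of_real (\<rho> (\<nu> (Suc k))) * z) - poly (snd (T k)) z) \<le> (1/2) ^ k"
    "bad k (m (Suc k)) (F (Suc k)) \<in> sets lborel"
    "emeasure lborel (bad k (m (Suc k)) (F (Suc k))) \<le> ennreal ((1/2) ^ k)" for k i z
    using st[of k] unfolding succ_state_def \<nu>_def F_def m_def by (simp_all add: case_prod_beta)
  have \<nu>: "strict_mono \<nu>" and m: "strict_mono m"
    using step(1,2) by (auto simp: strict_mono_Suc_iff)
  have \<rho>\<nu>: "(\<lambda>k. \<rho> (\<nu> k)) \<longlonglongrightarrow> 1"
    using LIMSEQ_subseq_LIMSEQ[OF assms(3) \<nu>] by (simp add: o_def)
  have \<rho>_mono: "\<rho> (\<nu> k) \<le> \<rho> (\<nu> l)" if "k \<le> l" for k l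
    using assms(1) strict_mono_less_eq[OF \<nu>] that by (auto simp: incseq_def)
  \<comment> \<open>The sequence converges on the open unit disc; elsewhere \<open>lim\<close> may
    be an unspecified value, and no such value enters below.\<close>
  define f where "f z = lim (\<lambda>l. poly (F l) z)" for z
  have f: "cmod (f z - poly (F l) z) \<le> 2 * (1/2) ^ l" if "cmod z \<le> \<rho> (\<nu> k)" "k \<le> l" for z k l
    unfolding f_def
  proof (rule telescoping_halves_limit[of k])
    show "cmod (poly (F (Suc l)) z - poly (F l) z) \<le> (1/2) ^ l" if "k \<le> l" for l
      using step(4) \<rho>_mono[OF that] \<open>cmod z \<le> \<rho> (\<nu> k)\<close> by simp
  qed (rule that)
  have ulim: "uniform_limit (cball 0 (\<rho> (\<nu> k))) (\<lambda>l. poly (F l)) f sequentially" for k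
    unfolding uniform_limit_sequentially_iff
  proof (intro allI impI)
    fix e :: real assume "e > 0"
    have "(\<lambda>l. 2 * (1/2) ^ l) \<longlonglongrightarrow> 2 * (0::real)"
      by (intro tendsto_intros LIMSEQ_realpow_zero) auto
    then have "eventually (\<lambda>l. 2 * (1/2) ^ l < e) sequentially"
      using \<open>e > 0\<close> by (intro order_tendstoD(2)[where y = "2 * 0"]) auto
    then obtain N where N: "\<And>l. l \<ge> N \<Longrightarrow> 2 * (1/2) ^ l < e"
      unfolding eventually_sequentially by blast
    have "dist (poly (F l) z) (f z) < e" if "l \<ge> max k N" "z \<in> cball 0 (\<rho> (\<nu> k))" for l z
      using f[of z k l] N[of l] that by (simp add: dist_norm norm_minus_commute)
    then show "\<exists>N. \<forall>n\<ge>N. \<forall>z\<in>cball 0 (\<rho> (\<nu> k)). dist (poly (F n) z) (f z) < e" by blast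
  qed
  have near1: "\<exists>k. c < \<rho> (\<nu> k)" if "c < 1" for c
    using order_tendstoD(1)[OF \<rho>\<nu> that] unfolding eventually_sequentially by blast
  have hol: "f holomorphic_on ball 0 1"
  proof (rule holomorphic_uniform_sequence[where f = "\<lambda>l. poly (F l)"])
    fix z :: complex assume z: "z \<in> ball 0 1"
    \<comment> \<open>Half the distance from \<open>z\<close> to the unit circle, so the closed disc
      about \<open>z\<close> fits into some disc of radius \<open>\<rho> (\<nu> k)\<close>.\<close>
    define d where "d = (1 - cmod z) / 2"
    obtain k where k: "cmod z + d < \<rho> (\<nu> k)"
      using near1[of "cmod z + d"] z unfolding d_def by (auto simp: field_simps)
    have sub: "cball z d \<subseteq> cball 0 (\<rho> (\<nu> k))"
    proof
      fix w assume "w \<in> cball z d"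
      then show "w \<in> cball 0 (\<rho> (\<nu> k))"
        using k norm_triangle_ineq2[of w z] by (auto simp: dist_norm norm_minus_commute)
    qed
    then show "\<exists>d>0. cball z d \<subseteq> ball 0 1 \<and> uniform_limit (cball z d) (\<lambda>l. poly (F l)) f sequentially"
      using z assms(2)[of "\<nu> k"] uniform_limit_on_subset[OF ulim sub]
      by (intro exI[of _ d]) (force simp: d_def)
  qed (auto intro!: holomorphic_intros)
  \<comment> \<open>Later blocks start at \<open>m (Suc k)\<close> or higher, so below that degree
    the coefficients of \<open>F k\<close> itself are already final.\<close>
  have coeffs: "coeff (F l) i = coeff (F k) i" if "k \<le> l" "i < m (Suc k)" for i k l
    using that(1)
  proof (induction l rule: dec_induct)
    case (step l)
    have "m (Suc k) \<le> m (Suc l)" using step(1) strict_mono_less_eq[OF m] by simp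
    then show ?case using step that(2) \<open>\<And>k i. i < m (Suc k) \<Longrightarrow> coeff (F (Suc k)) i = coeff (F k) i\<close> by simp
  qed simp
  \<comment> \<open>Locally uniform convergence carries over to derivatives at 0, and there the
    sequence of derivatives is eventually constant.\<close>
  have taylor: "taylor_coeff f i = coeff (F k) i" if "i < m (Suc k)" for i k
  proof -
    obtain k0 where k0: "0 < \<rho> (\<nu> k0)" using near1[of 0] by auto
    have "(\<lambda>l. (deriv ^^ i) (poly (F l)) 0) \<longlonglongrightarrow> (deriv ^^ i) f 0"
    proof (rule higher_deriv_complex_uniform_limit[where A = "ball 0 (\<rho> (\<nu> k0))"])
      show "uniform_limit (ball 0 (\<rho> (\<nu> k0))) (\<lambda>l. poly (F l)) f sequentially"
        by (rule uniform_limit_on_subset[OF ulim[of k0]]) auto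
      show "\<forall>\<^sub>F l in sequentially. poly (F l) holomorphic_on ball 0 (\<rho> (\<nu> k0))"
        by (intro always_eventually allI holomorphic_intros)
    qed (use k0 in auto)
    moreover have "(\<lambda>l. (deriv ^^ i) (poly (F l)) 0) \<longlonglongrightarrow> fact i * coeff (F k) i"
      by (rule tendsto_eventually, rule eventually_sequentiallyI[of k])
         (simp add: higher_deriv_poly_0 coeffs that)
    ultimately have "(deriv ^^ i) f 0 = fact i * coeff (F k) i"
      by (rule LIMSEQ_unique)
    then show ?thesis unfolding taylor_coeff_def by simp
  qed
  have partial: "partial_sum f n z = (\<Sum>i\<le>n. coeff (F k) i * z ^ i)" if "n < m (Suc k)" for n z k
    unfolding partial_sum_def by (intro sum.cong) (use that taylor in auto)
  have "f \<in> U_A \<rho>"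
    unfolding U_A_def
  proof (intro CollectI conjI hol allI impI, elim conjE)
    fix K :: "complex set" and \<phi> :: "complex \<Rightarrow> complex"
    assume K: "compact K" "K \<subseteq> sphere 0 1" "K \<noteq> sphere 0 1" and \<phi>: "continuous_on K \<phi>"
    show "\<exists>n. strict_mono n \<and> uniform_limit K (\<lambda>k \<zeta>. f (complex_of_real (\<rho> (n k)) * \<zeta>)) \<phi> sequentially"
    proof (rule exists_strict_mono_uniform_limit)
      fix \<epsilon> :: real and N :: nat assume \<epsilon>: "\<epsilon> > 0"
      have "(\<lambda>l. (1/2) ^ l) \<longlonglongrightarrow> (0::real)"
        by (intro LIMSEQ_realpow_zero) auto
      then have "eventually (\<lambda>l. (1/2) ^ l < \<epsilon> / 3) sequentially"
        using \<epsilon> by (intro order_tendstoD(2)[where y = 0]) auto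
      then obtain M where M: "\<And>l. l \<ge> M \<Longrightarrow> (1/2) ^ l < \<epsilon> / 3"
        unfolding eventually_sequentially by blast
      obtain k where k: "k \<ge> max M N" "K \<subseteq> fst (T k)" "\<And>z. z \<in> K \<Longrightarrow> cmod (poly (snd (T k)) z - \<phi> z) < \<epsilon> / 3"
        using T(2)[OF K \<phi>, of "\<epsilon> / 3" "max M N"] \<epsilon> by auto
      \<comment> \<open>Three errors below \<open>\<epsilon> / 3\<close>: the remaining blocks
        contribute at most \<open>2 * (1/2) ^ (k+1) = (1/2) ^ k\<close>, step \<open>k\<close>
        misses its target by at most \<open>(1/2) ^ k\<close>, and the target is close to
        \<open>\<phi>\<close>.\<close>
      have "cmod (f (of_real (\<rho> (\<nu> (Suc k))) * z) - \<phi> z) < \<epsilon>" if z: "z \<in> K" for z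
      proof -
        let ?w = "complex_of_real (\<rho> (\<nu> (Suc k))) * z"
        have "cmod ?w \<le> \<rho> (\<nu> (Suc k))" using z K(2) assms(2) by (auto simp: norm_mult)
        then have 1: "cmod (f ?w - poly (F (Suc k)) ?w) < \<epsilon> / 3"
          using f[of ?w "Suc k" "Suc k"] M[of k] k(1) by simp
        have 2: "cmod (poly (F (Suc k)) ?w - poly (snd (T k)) z) < \<epsilon> / 3"
          using step(5)[of z k] M[of k] k(1,2) z by force
        show ?thesis
          using 1 2 k(3)[OF z] norm_triangle_ineq[of "f ?w - poly (F (Suc k)) ?w" "poly (F (Suc k)) ?w - poly (snd (T k)) z"]
            norm_triangle_ineq[of "f ?w - poly (snd (T k)) z" "poly (snd (T k)) z - \<phi> z"] by simp
      qed
      moreover have "\<nu> (Suc k) > N"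
        using strict_mono_imp_increasing[OF \<nu>, of "Suc k"] k(1) by simp
      ultimately show "\<exists>n>N. \<forall>z\<in>K. cmod (f (complex_of_real (\<rho> n) * z) - \<phi> z) < \<epsilon>" by blast
    qed
  qed
  moreover have "AE t in lborel. t \<in> {0..2*pi} \<longrightarrow>
           filterlim (\<lambda>n. partial_sum f n (cis t)) at_infinity sequentially"
  proof -
    define E where "E k = bad k (m (Suc k)) (F (Suc k))" for k
    \<comment> \<open>Borel-Cantelli, the measures of the sets \<open>E k\<close> being dominated by
      a geometric series.\<close>
    have "AE t in lborel. eventually (\<lambda>k. t \<in> space lborel - E k) sequentially"
    proof (rule borel_cantelli_AE1)
      show "E k \<in> sets lborel" for k unfolding E_def by (rule step)
      have em: "emeasure lborel (E k) \<le> ennreal ((1/2) ^ k)" for k unfolding E_def by (rule step)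
      show "emeasure lborel (E k) < \<infinity>" for k
        using em[of k] by (simp add: le_less_trans)
      show "summable (\<lambda>k. measure lborel (E k))"
      proof (rule summable_comparison_test')
        show "summable (\<lambda>k. (1/2) ^ k :: real)" by (rule summable_geometric) simp
        show "norm (measure lborel (E k)) \<le> (1/2) ^ k" for k
          using em[of k] by (simp add: measure_def enn2real_leI)
      qed
    qed
    then show ?thesis
    proof (rule AE_mp, intro AE_I2 impI)
      fix t :: real
      assume ev: "eventually (\<lambda>k. t \<in> space lborel - E k) sequentially" and t: "t \<in> {0..2*pi}"
      then obtain k0 where k0: "\<And>k. k \<ge> k0 \<Longrightarrow> t \<notin> E k" unfolding eventually_sequentially by blast
      show "filterlim (\<lambda>n. partial_sum f n (cis t)) at_infinity sequentially"
        unfolding filterlim_at_infinity[OF order.refl]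
      proof (intro allI impI)
        fix R :: real assume "R > 0"
        define k1 where "k1 = max k0 (nat \<lceil>R\<rceil>)"
        have "R \<le> cmod (partial_sum f n (cis t))" if n: "n \<ge> m (Suc k1)" for n
        proof -
          \<comment> \<open>This locates the block of \<open>n\<close>: with
            \<open>j = k + 2\<close> one gets \<open>m (k+1) \<le> n < m (k+2)\<close>. The upper
            bound identifies the partial sum of \<open>f\<close> with that of
            \<open>F (k+1)\<close>; the lower bound makes \<open>t \<notin> E k\<close> applicable
            to it.\<close>
          define j where "j = (LEAST j. n < m j)"
          have "n < m (Suc n)" using strict_mono_imp_increasing[OF m, of "Suc n"] by simp
          then have j: "n < m j" unfolding j_def by (rule LeastI)
          have "m (Suc k1) < m j" using n j by simp
          then have "Suc k1 < j" by (simp add: strict_mono_less[OF m])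
          then obtain k where k: "j = Suc (Suc k)" "k \<ge> k1"
            by (cases j; cases "j - 1") auto
          have "\<not> n < m (Suc k)" using not_less_Least[of "Suc k" "\<lambda>j. n < m j"] k(1) unfolding j_def[symmetric] by simp
          moreover have "t \<notin> bad k (m (Suc k)) (F (Suc k))" using k0[of k] k(2) unfolding E_def k1_def by simp
          ultimately have "real (Suc k) \<le> cmod (\<Sum>i\<le>n. coeff (F (Suc k)) i * cis t ^ i)"
            using t unfolding bad_def by (auto simp: not_less)
          then have "real (Suc k) \<le> cmod (partial_sum f n (cis t))"
            using partial[of n "Suc k" "cis t"] j k(1) by simp
          moreover have "R \<le> real k" using k(2) unfolding k1_def by linarith
          ultimately show ?thesis by simp
        qed
        then show "\<forall>\<^sub>F n in sequentially. R \<le> cmod (partial_sum f n (cis t))"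
          by (rule eventually_sequentiallyI)
      qed
    qed
  qed
  ultimately show ?thesis by blast
qed

end
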